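(* Let $\mathbb{F}$ be a field of characteristic zero. All derivations of the Lie algebra $W_{\mathrm{fin}}(\mathbb{F})$ are inner; that is, for every derivation $d$ of $W_{\mathrm{fin}}(\mathbb{F})$ there exists $a\in W_{\mathrm{fin}}(\mathbb{F})$ such that $d(x)=[x,a]$ for all $x\in W_{\mathrm{fin}}(\mathbb{F})$.
   Context: Let $X=\{x_1,x_2,\dots\}$ be a countably infinite set of variables and $\mathbb{F}[X]$ the (commutative) polynomial algebra. $W_X(\mathbb{F})=\mathrm{Der}\,\mathbb{F}[X]$ is the Lie algebra (under commutator) of all $\mathbb{F}$-linear derivations of $\mathbb{F}[X]$; its elements are exactly the (possibly infinite) sums $\sum_{i=1}^\infty f_i\frac{\partial}{\partial x_i}$ with $f_i\in\mathbb{F}[X]$. $W_{\mathrm{fin}}(\mathbb{F})$ is the Lie subalgebra of $W_X(\mathbb{F})$ consisting of all $\sum_{i=1}^\infty f_i\frac{\partial}{\partial x_i}$, $f_i \in \mathbb{F}[X]$, such that each variable $x_n\in X$ occurs in only finitely many of the polynomials $f_i$, $i\ge1$. A derivation of a Lie algebra $L$ is an $\mathbb{F}$-linear map $d:L\to L$ with $d([x,y])=[d(x),y]+[x,d(y)]$. *)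

theory Defs
  imports Complex_Main "HOL-Library.Poly_Mapping"
begin

(* The polynomial algebra F[x_0, x_1, x_2, ...]: the monomial m is the exponent vector
   "nat \<Rightarrow>\<^sub>0 nat", and multiplication is the convolution product of Poly_Mapping. *)

type_synonym 'a ipoly = "(nat \<Rightarrow>\<^sub>0 nat) \<Rightarrow>\<^sub>0 'a"

definition PVar :: "nat \<Rightarrow> 'a::field_char_0 ipoly" where
  "PVar i = Poly_Mapping.single (Poly_Mapping.single i 1) 1"

definition poly_scale :: "'a::field_char_0 \<Rightarrow> 'a ipoly \<Rightarrow> 'a ipoly" where
  "poly_scale c p = Poly_Mapping.map ((*) c) p"

definition occurring :: "'a::field_char_0 ipoly \<Rightarrow> nat set" where
  "occurring p = (\<Union>m\<in>Poly_Mapping.keys p. Poly_Mapping.keys m)"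

(* The truncated subtraction of exponents is harmless: where x_i does not occur in m, the
   coefficient is zero. *)
definition pderiv_var :: "nat \<Rightarrow> 'a::field_char_0 ipoly \<Rightarrow> 'a ipoly" where
  "pderiv_var i p = (\<Sum>m\<in>Poly_Mapping.keys p.
     Poly_Mapping.single (m - Poly_Mapping.single i 1)
       (of_nat (Poly_Mapping.lookup m i) * Poly_Mapping.lookup p m))"

(* The infinite sum of the f i * d/dx_i, evaluated at p: only the finitely many variables that
   occur in p contribute. *)
definition vector_field :: "(nat \<Rightarrow> 'a::field_char_0 ipoly) \<Rightarrow> 'a ipoly \<Rightarrow> 'a ipoly" where
  "vector_field f p = (\<Sum>i\<in>occurring p. f i * pderiv_var i p)"

definition W_X :: "('a::field_char_0 ipoly \<Rightarrow> 'a ipoly) set" where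
  "W_X = {D. (\<forall>p q. D (p + q) = D p + D q) \<and>
             (\<forall>c p. D (poly_scale c p) = poly_scale c (D p)) \<and>
             (\<forall>p q. D (p * q) = D p * q + p * D q)}"

definition W_fin :: "('a::field_char_0 ipoly \<Rightarrow> 'a ipoly) set" where
  "W_fin = {vector_field f | f. \<forall>n. finite {i. n \<in> occurring (f i)}}"

definition bracket ::
  "('a::field_char_0 ipoly \<Rightarrow> 'a ipoly) \<Rightarrow> ('a ipoly \<Rightarrow> 'a ipoly) \<Rightarrow> 'a ipoly \<Rightarrow> 'a ipoly" where
  "bracket D E = (\<lambda>p. D (E p) - E (D p))"

(* Derivations of a Lie subalgebra L of W_X. The ambient maps are total, so everything is
   relativised to L; values outside L are irrelevant. *)
definition lie_derivation ::
  "('a::field_char_0 ipoly \<Rightarrow> 'a ipoly) set \<Rightarrow>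
   (('a ipoly \<Rightarrow> 'a ipoly) \<Rightarrow> ('a ipoly \<Rightarrow> 'a ipoly)) \<Rightarrow> bool" where
  "lie_derivation L d \<longleftrightarrow>
     (\<forall>x\<in>L. d x \<in> L) \<and>
     (\<forall>x\<in>L. \<forall>y\<in>L. d (\<lambda>p. x p + y p) = (\<lambda>p. d x p + d y p)) \<and>
     (\<forall>c. \<forall>x\<in>L. d (\<lambda>p. poly_scale c (x p)) = (\<lambda>p. poly_scale c (d x p))) \<and>
     (\<forall>x\<in>L. \<forall>y\<in>L. d (bracket x y) = (\<lambda>p. bracket (d x) y p + bracket x (d y) p))"

lemma poly_scale_conv_mult: "poly_scale c p = Poly_Mapping.single 0 c * p"
  unfolding poly_scale_def by (rule mult_map_scale_conv_mult)

lemma finite_occurring [simp]: "finite (occurring p)"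
  by (simp add: occurring_def)

lemma pderiv_var_superset:
  assumes "finite S" "Poly_Mapping.keys p \<subseteq> S"
  shows "pderiv_var i p = (\<Sum>m\<in>S. Poly_Mapping.single (m - Poly_Mapping.single i 1)
     (of_nat (Poly_Mapping.lookup m i) * Poly_Mapping.lookup p m))"
  unfolding pderiv_var_def
  by (rule sum.mono_neutral_left) (use assms in \<open>auto simp: in_keys_iff\<close>)

lemma pderiv_var_zero [simp]: "pderiv_var i 0 = 0"
  by (simp add: pderiv_var_def)

lemma pderiv_var_add: "pderiv_var i (p + q) = pderiv_var i p + pderiv_var i q"
proof -
  let ?S = "Poly_Mapping.keys p \<union> Poly_Mapping.keys q"
  have "Poly_Mapping.keys (p + q) \<subseteq> ?S" by (rule keys_add)
  then show ?thesis
    by (simp add: pderiv_var_superset[of ?S] lookup_add distrib_left single_add sum.distrib)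
qed

lemma pderiv_var_single:
  "pderiv_var i (Poly_Mapping.single m c) =
     Poly_Mapping.single (m - Poly_Mapping.single i 1) (of_nat (Poly_Mapping.lookup m i) * c)"
  by (simp add: pderiv_var_superset[of "{m}"])

lemma ipoly_induct [case_names zero single_add]:
  assumes "P 0" "\<And>m c p. P p \<Longrightarrow> P (Poly_Mapping.single m c + p)"
  shows "P (p :: 'a::field_char_0 ipoly)"
proof (induction p rule: update_induct)
  case const
  then show ?case by fact
next
  case (update f a b)
  have "Poly_Mapping.update a b f = Poly_Mapping.single a b + f"
    using update by (intro poly_mapping_eqI)
      (auto simp: lookup_update lookup_add lookup_single when_def in_keys_iff)
  then show ?case using assms(2) update by simp
qed

lemma exponent_diff_single:
  fixes m n :: "nat \<Rightarrow>\<^sub>0 nat"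
  assumes "Poly_Mapping.lookup m i \<noteq> 0"
  shows "m - Poly_Mapping.single i 1 + n = m + n - Poly_Mapping.single i 1"
  using assms by (intro poly_mapping_eqI) (auto simp: lookup_add lookup_minus lookup_single when_def)

lemma pderiv_var_mult_single:
  fixes a b :: "'a::field_char_0"
  shows "pderiv_var i (Poly_Mapping.single m a * Poly_Mapping.single n b) =
    pderiv_var i (Poly_Mapping.single m a) * Poly_Mapping.single n b +
    Poly_Mapping.single m a * pderiv_var i (Poly_Mapping.single n b)"
proof -
  have 1: "pderiv_var i (Poly_Mapping.single m a) * Poly_Mapping.single n b =
    Poly_Mapping.single (m + n - Poly_Mapping.single i 1) (of_nat (Poly_Mapping.lookup m i) * a * b)"
    for m n and a b :: 'a
    by (cases "Poly_Mapping.lookup m i = 0")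
       (simp_all add: pderiv_var_single mult_single exponent_diff_single[simplified])
  have 2: "Poly_Mapping.single m a * pderiv_var i (Poly_Mapping.single n b) =
    Poly_Mapping.single (m + n - Poly_Mapping.single i 1) (of_nat (Poly_Mapping.lookup n i) * a * b)"
    using 1[of n b m a] by (simp only: mult.commute[of "Poly_Mapping.single m a"] add.commute mult.assoc mult.commute[of a])
  have "of_nat (Poly_Mapping.lookup (m + n) i) * (a * b) =
    of_nat (Poly_Mapping.lookup m i) * a * b + of_nat (Poly_Mapping.lookup n i) * a * b"
    by (simp add: lookup_add algebra_simps)
  then show ?thesis
    unfolding 1 2 by (simp only: mult_single pderiv_var_single flip: Poly_Mapping.single_add)
qed

lemma pderiv_var_mult: "pderiv_var i (p * q) = pderiv_var i p * q + p * pderiv_var i q"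
proof (induction p rule: ipoly_induct)
  case (single_add m c p)
  have "pderiv_var i (Poly_Mapping.single m c * q) =
    pderiv_var i (Poly_Mapping.single m c) * q + Poly_Mapping.single m c * pderiv_var i q"
    by (induction q rule: ipoly_induct)
       (simp_all add: pderiv_var_add pderiv_var_mult_single algebra_simps)
  then show ?case
    by (simp add: single_add pderiv_var_add algebra_simps)
qed simp

lemma pderiv_var_scale: "pderiv_var i (poly_scale c p) = poly_scale c (pderiv_var i p)"
  by (simp add: poly_scale_conv_mult pderiv_var_mult pderiv_var_single)

lemma pderiv_var_PVar: "pderiv_var i (PVar j) = (if i = j then 1 else 0)"
  by (auto simp: PVar_def pderiv_var_single lookup_single)

lemma pderiv_var_not_occurring:
  assumes "i \<notin> occurring p" shows "pderiv_var i p = 0"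
  unfolding pderiv_var_def
  by (rule sum.neutral) (use assms in \<open>auto simp: occurring_def in_keys_iff\<close>)

lemma vector_field_superset:
  assumes "finite S" "occurring p \<subseteq> S"
  shows "vector_field f p = (\<Sum>i\<in>S. f i * pderiv_var i p)"
  unfolding vector_field_def
  by (rule sum.mono_neutral_left) (use assms pderiv_var_not_occurring in auto)

lemma occurring_PVar [simp]: "occurring (PVar i) = {i}"
  by (simp add: occurring_def PVar_def)

lemma vector_field_PVar [simp]: "vector_field f (PVar i) = f i"
  by (simp add: vector_field_def pderiv_var_PVar)

lemma occurring_add: "occurring (p + q) \<subseteq> occurring p \<union> occurring q"
  using keys_add[of p q] by (auto simp: occurring_def)

lemma occurring_uminus [simp]: "occurring (- p) = occurring p"
  by (auto simp: occurring_def in_keys_iff)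

lemma occurring_diff: "occurring (p - q) \<subseteq> occurring p \<union> occurring q"
  using occurring_add[of p "- q"] by simp

lemma occurring_mult: "occurring (p * q) \<subseteq> occurring p \<union> occurring q"
proof
  fix i assume "i \<in> occurring (p * q)"
  then obtain m where m: "m \<in> Poly_Mapping.keys (p * q)" "i \<in> Poly_Mapping.keys m"
    by (auto simp: occurring_def)
  then obtain a b where "m = a + b" "a \<in> Poly_Mapping.keys p" "b \<in> Poly_Mapping.keys q"
    using keys_mult[of p q] by blast
  then show "i \<in> occurring p \<union> occurring q"
    using m keys_add[of a b] by (auto simp: occurring_def)
qed

lemma occurring_sum: "occurring (sum f A) \<subseteq> (\<Union>a\<in>A. occurring (f a))"
proof (induction A rule: infinite_finite_induct)
  case (insert x F)
  then show ?case using occurring_add[of "f x" "sum f F"] by auto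
qed (simp_all add: occurring_def)

lemma occurring_pderiv_var: "occurring (pderiv_var i p) \<subseteq> occurring p"
  unfolding pderiv_var_def
proof (rule order_trans[OF occurring_sum], rule UN_least)
  fix m assume m: "m \<in> Poly_Mapping.keys p"
  have "Poly_Mapping.keys (m - Poly_Mapping.single i 1) \<subseteq> Poly_Mapping.keys m"
    by (auto simp: in_keys_iff lookup_minus)
  then show "occurring (Poly_Mapping.single (m - Poly_Mapping.single i 1)
      (of_nat (Poly_Mapping.lookup m i) * Poly_Mapping.lookup p m)) \<subseteq> occurring p"
    using m by (auto simp: occurring_def split: if_splits)
qed

lemma vector_field_in_W_X: "vector_field f \<in> W_X"
proof -
  have "vector_field f (p + q) = vector_field f p + vector_field f q" for p q
  proof -
    let ?S = "occurring p \<union> occurring q"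
    show ?thesis
      using occurring_add[of p q]
      by (simp add: vector_field_superset[of ?S] pderiv_var_add distrib_left sum.distrib)
  qed
  moreover have mult: "vector_field f (p * q) = vector_field f p * q + p * vector_field f q" for p q
  proof -
    let ?S = "occurring p \<union> occurring q"
    show ?thesis
      using occurring_mult[of p q]
      by (simp add: vector_field_superset[of ?S] pderiv_var_mult sum_distrib_left
          sum_distrib_right algebra_simps flip: sum.distrib)
  qed
  moreover have "vector_field f (Poly_Mapping.single 0 c) = 0" for c
    by (simp add: vector_field_def occurring_def)
  ultimately show ?thesis
    by (simp add: W_X_def poly_scale_conv_mult)
qed

lemma W_X_determined:
  assumes D: "D \<in> W_X" and E: "E \<in> W_X" and eq: "\<And>i. D (PVar i) = E (PVar i)"
  shows "D = E"
proof
  have add: "D (p + q) = D p + D q" "E (p + q) = E p + E q" for p q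
    using D E by (auto simp: W_X_def)
  have mult: "D (p * q) = D p * q + p * D q" "E (p * q) = E p * q + p * E q" for p q
    using D E by (auto simp: W_X_def)
  have scale: "D (poly_scale c p) = poly_scale c (D p)" "E (poly_scale c p) = poly_scale c (E p)"
    for c p using D E by (auto simp: W_X_def)
  have zero: "D 0 = 0" "E 0 = 0" using add[of 0 0] by simp_all
  have one: "D 1 = 0" "E 1 = 0" using mult[of 1 1] by simp_all
  have pow: "D (PVar i ^ k) = E (PVar i ^ k)" for i k
    by (induction k) (simp_all add: one mult eq)
  have mon: "D (Poly_Mapping.single m 1) = E (Poly_Mapping.single m 1)" for m
  proof (induction m rule: update_induct)
    case const
    then show ?case by (simp add: one)
  next
    case (update f i k)
    have p: "PVar i ^ k = Poly_Mapping.single (Poly_Mapping.single i k) (1::'a)" for k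
      by (induction k) (simp_all add: PVar_def mult_single flip: Poly_Mapping.single_add)
    have "Poly_Mapping.update i k f = Poly_Mapping.single i k + f"
      using update by (intro poly_mapping_eqI)
        (auto simp: lookup_update lookup_add lookup_single when_def in_keys_iff)
    then have "Poly_Mapping.single (Poly_Mapping.update i k f) (1::'a) =
        PVar i ^ k * Poly_Mapping.single f 1"
      by (simp add: p mult_single)
    then show ?case by (simp add: mult pow update)
  qed
  have sing: "D (Poly_Mapping.single m c) = E (Poly_Mapping.single m c)" for m c
    using scale[of c "Poly_Mapping.single m 1"] mon[of m]
    by (simp add: poly_scale_conv_mult mult_single)
  show "D p = E p" for p
    by (induction p rule: ipoly_induct) (simp_all add: zero add sing)
qed

lemma W_X_expansion:
  assumes "D \<in> W_X" shows "D = vector_field (\<lambda>i. D (PVar i))"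
proof (rule W_X_determined[OF assms vector_field_in_W_X])
  show "D (PVar i) = vector_field (\<lambda>i. D (PVar i)) (PVar i)" for i
    by (simp only: vector_field_PVar)
qed

lemma W_X_eq_range: "W_X = range vector_field"
proof
  show "W_X \<subseteq> range vector_field"
    by (rule subsetI, rule range_eqI, rule W_X_expansion)
  show "range vector_field \<subseteq> W_X"
    by (rule image_subsetI) (rule vector_field_in_W_X)
qed

lemma W_fin_iff: "D \<in> W_fin \<longleftrightarrow> D \<in> W_X \<and> (\<forall>n. finite {i. n \<in> occurring (D (PVar i))})"
proof
  assume "D \<in> W_fin"
  then show "D \<in> W_X \<and> (\<forall>n. finite {i. n \<in> occurring (D (PVar i))})"
    by (auto simp: W_fin_def vector_field_in_W_X)
next
  assume D: "D \<in> W_X \<and> (\<forall>n. finite {i. n \<in> occurring (D (PVar i))})"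
  show "D \<in> W_fin"
    unfolding W_fin_def
    by (rule CollectI, rule exI[of _ "\<lambda>i. D (PVar i)"])
       (use D W_X_expansion in \<open>intro conjI, blast+\<close>)
qed

lemma W_X_bracket:
  assumes "D \<in> W_X" "E \<in> W_X" shows "bracket D E \<in> W_X"
proof -
  have add: "D (p + q) = D p + D q" "E (p + q) = E p + E q" for p q
    using assms by (auto simp: W_X_def)
  have mult: "D (p * q) = D p * q + p * D q" "E (p * q) = E p * q + p * E q" for p q
    using assms by (auto simp: W_X_def)
  have "D (poly_scale c p) = poly_scale c (D p)" "E (poly_scale c p) = poly_scale c (E p)"
    for c p using assms by (auto simp: W_X_def)
  then show ?thesis
    by (simp add: W_X_def bracket_def add mult algebra_simps)
       (simp add: poly_scale_conv_mult algebra_simps)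
qed

lemma W_fin_add:
  assumes "D \<in> W_fin" "E \<in> W_fin" shows "(\<lambda>p. D p + E p) \<in> W_fin"
proof -
  have "(\<lambda>p. D p + E p) \<in> W_X"
    using assms by (auto simp: W_fin_iff W_X_def poly_scale_conv_mult algebra_simps)
  moreover have "finite {i. n \<in> occurring (D (PVar i) + E (PVar i))}" for n
    by (rule finite_subset[of _ "{i. n \<in> occurring (D (PVar i))} \<union> {i. n \<in> occurring (E (PVar i))}"])
       (use assms occurring_add in \<open>auto simp: W_fin_iff\<close>)
  ultimately show ?thesis by (simp add: W_fin_iff)
qed

lemma occurring_scale: "occurring (poly_scale c p) \<subseteq> occurring p"
proof -
  have "occurring (Poly_Mapping.single 0 c) = {}"
    by (simp add: occurring_def)
  then show ?thesis
    using occurring_mult[of "Poly_Mapping.single 0 c" p] by (simp add: poly_scale_conv_mult)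
qed

lemma W_fin_scale:
  assumes "D \<in> W_fin" shows "(\<lambda>p. poly_scale c (D p)) \<in> W_fin"
proof -
  have D: "D (p + q) = D p + D q" "D (poly_scale b p) = poly_scale b (D p)"
    "D (p * q) = D p * q + p * D q" for b p q
    using assms by (auto simp: W_fin_iff W_X_def)
  have "poly_scale c (p + q) = poly_scale c p + poly_scale c q"
    "poly_scale c (poly_scale b p) = poly_scale b (poly_scale c p)"
    "poly_scale c (p * q) = poly_scale c p * q"
    "poly_scale c (p * q) = p * poly_scale c q" for b and p q :: "'a ipoly"
    by (simp_all only: poly_scale_conv_mult algebra_simps)
  then have "(\<lambda>p. poly_scale c (D p)) \<in> W_X"
    unfolding W_X_def mem_Collect_eq D by metis
  moreover have "finite {i. n \<in> occurring (poly_scale c (D (PVar i)))}" for n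
    by (rule finite_subset[of _ "{i. n \<in> occurring (D (PVar i))}"])
       (use assms occurring_scale in \<open>auto simp: W_fin_iff\<close>)
  ultimately show ?thesis by (simp add: W_fin_iff)
qed

lemma W_fin_apply_finite:
  assumes f: "\<And>n. finite {i. n \<in> occurring (f i)}" and g: "\<And>n. finite {i. n \<in> occurring (g i)}"
  shows "finite {i. n \<in> occurring (vector_field f (g i))}"
proof (rule finite_subset)
  show "finite ({i. n \<in> occurring (g i)} \<union>
      (\<Union>j\<in>{j. n \<in> occurring (f j)}. {i. j \<in> occurring (g i)}))"
    using f g by auto
  show "{i. n \<in> occurring (vector_field f (g i))} \<subseteq> {i. n \<in> occurring (g i)} \<union>
      (\<Union>j\<in>{j. n \<in> occurring (f j)}. {i. j \<in> occurring (g i)})"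
  proof
    fix i assume "i \<in> {i. n \<in> occurring (vector_field f (g i))}"
    then obtain j where "j \<in> occurring (g i)" "n \<in> occurring (f j * pderiv_var j (g i))"
      unfolding vector_field_def using occurring_sum by fastforce
    then show "i \<in> {i. n \<in> occurring (g i)} \<union>
        (\<Union>j\<in>{j. n \<in> occurring (f j)}. {i. j \<in> occurring (g i)})"
      using occurring_mult[of "f j" "pderiv_var j (g i)"] occurring_pderiv_var[of j "g i"] by blast
  qed
qed

lemma W_fin_bracket:
  assumes "D \<in> W_fin" "E \<in> W_fin" shows "bracket D E \<in> W_fin"
proof -
  obtain f g where f: "D = vector_field f" "\<And>n. finite {i. n \<in> occurring (f i)}"
    and g: "E = vector_field g" "\<And>n. finite {i. n \<in> occurring (g i)}"
    using assms by (auto simp: W_fin_def)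
  have "finite {i. n \<in> occurring (bracket D E (PVar i))}" for n
    by (rule finite_subset[of _ "{i. n \<in> occurring (vector_field f (g i))} \<union>
          {i. n \<in> occurring (vector_field g (f i))}"])
       (use occurring_diff W_fin_apply_finite[OF f(2) g(2)] W_fin_apply_finite[OF g(2) f(2)]
         in \<open>auto simp: bracket_def f(1) g(1)\<close>)
  moreover have "bracket D E \<in> W_X"
    using assms by (auto simp: W_fin_iff intro: W_X_bracket)
  ultimately show ?thesis by (simp add: W_fin_iff)
qed

end

theory Submission
  imports Defs
begin

text \<open>Write \<partial>_i for \<partial>/\<partial>x_i and E for the Euler field, the sum of
  all x_i \<partial>_i. Bracketing with E multiplies a component's coefficient by its degree minus
  one, so \<open>d\<close> E = [E, a] forces every coefficient of a except the linear ones; those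
  are forced by the constant terms of \<open>d\<close> \<partial>_i. The relations [\<partial>_i, D]
  = l_i \<partial>_i for diagonal fields D (\<open>lie_derivation_diag_coeff\<close>) show that the
  field a so defined fits all these values and lies in \<open>W_fin\<close>
  (\<open>lie_derivation_inner_on_generators\<close>).

  Subtracting [x, a] leaves a derivation that kills E and all \<partial>_i. It kills x^m
  \<partial>_k by induction on the degree (\<open>monomial_field\<close>): brackets with the
  \<partial>_i show that the image is a constant field, and constant fields have the wrong
  eigenvalue under E. Linearity extends this only to fields with finitely many components
  (\<open>finite_field\<close>), as no continuity is available for infinite sums. The condition
  defining \<open>W_fin\<close> bridges the gap: bracketing any x with \<partial>_i or x_j
  \<partial>_j gives a field with finitely many components, and these brackets determine the image
  of x (\<open>vanishes\<close>).\<close>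

section \<open>Weights of monomials and coefficients of derivatives\<close>

text \<open>The weighted degree of a monomial; with all weights 1 it is the total degree.\<close>

definition wt :: "(nat \<Rightarrow> 'a) \<Rightarrow> (nat \<Rightarrow>\<^sub>0 nat) \<Rightarrow> 'a::comm_semiring_1" where
  "wt l m = (\<Sum>i\<in>Poly_Mapping.keys m. of_nat (Poly_Mapping.lookup m i) * l i)"

text \<open>The sum of the l_i x_i \<partial>_i. Each variable occurs in at most one coefficient, so
  arbitrary \<open>l\<close> is allowed in \<open>W_fin\<close>; constant 1 gives the Euler
  field.\<close>

definition diag_field :: "(nat \<Rightarrow> 'a::field_char_0) \<Rightarrow> 'a ipoly \<Rightarrow> 'a ipoly" where
  "diag_field l = vector_field (\<lambda>i. Poly_Mapping.single (Poly_Mapping.single i 1) (l i))"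

lemma wt_superset:
  assumes "finite S" "Poly_Mapping.keys m \<subseteq> S"
  shows "wt l m = (\<Sum>i\<in>S. of_nat (Poly_Mapping.lookup m i) * l i)"
  unfolding wt_def by (rule sum.mono_neutral_left) (use assms in \<open>auto simp: in_keys_iff\<close>)

lemma wt_zero [simp]: "wt l 0 = 0"
  by (simp add: wt_def)

lemma wt_single [simp]: "wt l (Poly_Mapping.single i n) = of_nat n * l i"
  by (simp add: wt_def)

lemma wt_add: "wt l (m + n) = wt l m + wt l n"
proof -
  let ?S = "Poly_Mapping.keys m \<union> Poly_Mapping.keys n"
  have "Poly_Mapping.keys (m + n) \<subseteq> ?S" by (rule keys_add)
  then show ?thesis
    by (simp add: wt_superset[of ?S] lookup_add distrib_right sum.distrib)
qed

lemma wt_one_of_nat: "wt (\<lambda>_. 1) m = of_nat (wt (\<lambda>_. 1) m)"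
  by (simp add: wt_def)

text \<open>Characteristic zero reduces the claim to natural numbers, where a sum vanishes only if
  all its terms do.\<close>

lemma wt_one_eq_0_iff [simp]: "wt (\<lambda>_. 1) m = (0::'a::field_char_0) \<longleftrightarrow> m = 0"
proof -
  have "wt (\<lambda>_. 1::nat) m = 0 \<longleftrightarrow> m = 0"
    by (auto simp: wt_def in_keys_iff intro!: poly_mapping_eqI)
  then show ?thesis by (subst wt_one_of_nat) simp
qed

lemma exponent_diff_add:
  assumes "Poly_Mapping.lookup m i \<noteq> 0"
  shows "m - Poly_Mapping.single i 1 + Poly_Mapping.single i 1 = (m :: nat \<Rightarrow>\<^sub>0 nat)"
  using assms by (intro poly_mapping_eqI) (auto simp: lookup_add lookup_minus lookup_single when_def)

lemma lookup_poly_scale [simp]: "Poly_Mapping.lookup (poly_scale c p) m = c * Poly_Mapping.lookup p m"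
  by (simp add: poly_scale_def map.rep_eq when_def)

text \<open>Only the monomial x_i x^m contributes to x^m: where the truncated subtraction of
  exponents could create another preimage, the factor is zero.\<close>

lemma lookup_pderiv_var:
  "Poly_Mapping.lookup (pderiv_var i p) m =
     of_nat (Poly_Mapping.lookup m i + 1) * Poly_Mapping.lookup p (m + Poly_Mapping.single i 1)"
proof (induction p rule: ipoly_induct)
  case (single_add n c p)
  have "Poly_Mapping.lookup (pderiv_var i (Poly_Mapping.single n c)) m =
     of_nat (Poly_Mapping.lookup m i + 1) *
     Poly_Mapping.lookup (Poly_Mapping.single n c) (m + Poly_Mapping.single i 1)"
  proof (cases "n = m + Poly_Mapping.single i 1")
    case True
    then show ?thesis by (simp add: pderiv_var_single lookup_add)
  next
    case False
    show ?thesis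
    proof (cases "Poly_Mapping.lookup n i = 0")
      case True
      then show ?thesis using False by (simp add: pderiv_var_single lookup_single)
    next
      case nz: False
      have "n - Poly_Mapping.single i 1 \<noteq> m"
        using exponent_diff_add[OF nz] False by metis
      then show ?thesis using False by (simp add: pderiv_var_single lookup_single)
    qed
  qed
  then show ?case
    using single_add by (simp add: pderiv_var_add lookup_add distrib_left)
qed simp

text \<open>A coefficient at x^m survives differentiation by any variable of x^m, up to a positive
  exponent, which is nonzero in characteristic zero. So only constants have all partial derivatives
  zero.\<close>

lemma pderiv_var_eq_0_imp_lookup:
  assumes "\<And>i. pderiv_var i p = 0" "m \<noteq> 0"
  shows "Poly_Mapping.lookup p m = 0"
proof -
  from assms(2) obtain i where i: "Poly_Mapping.lookup m i \<noteq> 0"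
    by (metis lookup_zero poly_mapping_eqI)
  then show ?thesis
    using lookup_pderiv_var[of i p "m - Poly_Mapping.single i 1"] assms(1)[of i]
    by (simp add: exponent_diff_add[simplified] del: of_nat_Suc)
qed

section \<open>One-component and diagonal fields in \<open>W_fin\<close>\<close>

lemma W_X_linear:
  assumes "D \<in> W_X"
  shows W_X_add: "D (p + q) = D p + D q"
    and W_X_scale: "D (poly_scale c p) = poly_scale c (D p)"
    and W_X_zero: "D 0 = 0"
    and W_X_one: "D 1 = 0"
    and W_X_diff: "D (p - q) = D p - D q"
proof -
  show add: "D (p + q) = D p + D q" and "D (poly_scale c p) = poly_scale c (D p)" for p q
    using assms by (auto simp: W_X_def)
  have mult: "D (p * q) = D p * q + p * D q" for p q
    using assms by (auto simp: W_X_def)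
  show "D 0 = 0" using add[of 0 0] by simp
  show "D 1 = 0" using mult[of 1 1] by simp
  show "D (p - q) = D p - D q" using add[of "p - q" q] by (simp add: algebra_simps)
qed

lemma W_fin_imp_W_X: "D \<in> W_fin \<Longrightarrow> D \<in> W_X"
  by (simp add: W_fin_iff)

lemma W_fin_diff:
  assumes "D \<in> W_fin" "E \<in> W_fin" shows "(\<lambda>p. D p - E p) \<in> W_fin"
proof -
  have "poly_scale (-1) q = - q" for q :: "'a ipoly"
    by (intro poly_mapping_eqI) simp
  then show ?thesis
    using W_fin_add[OF assms(1) W_fin_scale[OF assms(2), of "-1"]] by simp
qed

lemma monomial_field_W_fin [simp]: "(\<lambda>p. q * pderiv_var k p) \<in> W_fin"
proof -
  have "(\<lambda>p. q * pderiv_var k p) \<in> W_X"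
    by (simp add: W_X_def pderiv_var_add pderiv_var_scale pderiv_var_mult algebra_simps)
       (simp add: poly_scale_conv_mult algebra_simps)
  moreover have "finite {i. n \<in> occurring (q * pderiv_var k (PVar i))}" for n
    by (rule finite_subset[of _ "{k}"]) (auto simp: pderiv_var_PVar occurring_def split: if_splits)
  ultimately show ?thesis by (simp add: W_fin_iff)
qed

lemma pderiv_var_W_fin [simp]: "pderiv_var k \<in> W_fin"
  using monomial_field_W_fin[of 1 k] by simp

lemma zero_W_fin [simp]: "(\<lambda>p. 0) \<in> W_fin"
  using monomial_field_W_fin[of 0 0] by simp

lemma diag_field_W_fin [simp]: "diag_field l \<in> W_fin"
  unfolding W_fin_def diag_field_def
  by (rule CollectI, intro exI conjI allI, rule refl)
     (auto intro!: finite_subset[of _ "{_}"] simp: occurring_def)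

lemma diag_field_PVar: "diag_field l (PVar k) = poly_scale (l k) (PVar k)"
  unfolding diag_field_def vector_field_PVar by (simp add: poly_scale_conv_mult PVar_def mult_single)

text \<open>Each x_i \<partial>_i multiplies a monomial by its exponent of x_i, so monomials are
  eigenvectors with their weights as eigenvalues.\<close>

lemma lookup_diag_field:
  "Poly_Mapping.lookup (diag_field l p) m = wt l m * Poly_Mapping.lookup p m"
proof (induction p rule: ipoly_induct)
  case zero
  then show ?case by (simp add: W_X_zero[OF W_fin_imp_W_X])
next
  case (single_add n c p)
  have "diag_field l (Poly_Mapping.single n c) =
      (\<Sum>i\<in>Poly_Mapping.keys n. Poly_Mapping.single (Poly_Mapping.single i 1) (l i) *
         pderiv_var i (Poly_Mapping.single n c))"
    unfolding diag_field_def by (rule vector_field_superset) (auto simp: occurring_def split: if_splits)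
  also have "\<dots> = (\<Sum>i\<in>Poly_Mapping.keys n.
      Poly_Mapping.single n (of_nat (Poly_Mapping.lookup n i) * l i * c))"
    by (rule sum.cong)
       (auto simp: pderiv_var_single mult_single in_keys_iff exponent_diff_add[simplified]
          add.commute[of "Poly_Mapping.single _ _"] mult_ac)
  finally have "Poly_Mapping.lookup (diag_field l (Poly_Mapping.single n c)) m =
      wt l m * Poly_Mapping.lookup (Poly_Mapping.single n c) m"
    by (auto simp: lookup_sum lookup_single when_def wt_def sum_distrib_right)
  then show ?case
    using single_add by (simp add: W_X_add[OF W_fin_imp_W_X] lookup_add distrib_left)
qed

lemma W_fin_eqI:
  assumes "D \<in> W_fin" "E \<in> W_fin" "\<And>k. D (PVar k) = E (PVar k)"
  shows "D = E"
  using assms by (intro W_X_determined) (auto dest: W_fin_imp_W_X)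

section \<open>Values of a derivation on partial derivatives and diagonal fields\<close>

lemma lie_derivationD:
  assumes "lie_derivation W_fin d" "x \<in> W_fin"
  shows lie_derivation_closed: "d x \<in> W_fin"
    and lie_derivation_add: "y \<in> W_fin \<Longrightarrow> d (\<lambda>p. x p + y p) = (\<lambda>p. d x p + d y p)"
    and lie_derivation_scale: "d (\<lambda>p. poly_scale c (x p)) = (\<lambda>p. poly_scale c (d x p))"
    and lie_derivation_bracket:
      "y \<in> W_fin \<Longrightarrow> d (bracket x y) = (\<lambda>p. bracket (d x) y p + bracket x (d y) p)"
  using assms by (auto simp: lie_derivation_def)

lemma lie_derivation_zero:
  assumes "lie_derivation W_fin d" shows "d (\<lambda>p. 0) = (\<lambda>p. 0)"
proof -
  have "poly_scale 0 q = 0" for q :: "'a ipoly" by (intro poly_mapping_eqI) simp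
  then show ?thesis
    using lie_derivation_scale[OF assms zero_W_fin, of 0] by simp
qed

lemma bracket_pderiv_diag:
  "bracket (pderiv_var i) (diag_field l) = (\<lambda>p. poly_scale (l i) (pderiv_var i p))"
proof (rule W_fin_eqI)
  have "diag_field l 0 = 0" "diag_field l 1 = 0"
    by (simp_all add: W_X_zero W_X_one W_fin_imp_W_X)
  then show "bracket (pderiv_var i) (diag_field l) (PVar k) = poly_scale (l i) (pderiv_var i (PVar k))" for k
    by (simp add: bracket_def diag_field_PVar pderiv_var_scale pderiv_var_PVar)
       (simp add: poly_scale_conv_mult)
qed (simp_all add: W_fin_bracket W_fin_scale)

text \<open>Apply \<open>d\<close> to \<open>bracket_pderiv_diag\<close> and compare coefficients in
  the k-th component. Constant weights 1 turn the factor on the left into the total degree; at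
  \<open>m = 0\<close> it is \<open>l i - l k\<close>.\<close>

lemma lie_derivation_diag_coeff:
  assumes d: "lie_derivation W_fin d"
  shows "(l i - l k + wt l m) * Poly_Mapping.lookup (d (pderiv_var i) (PVar k)) m =
    of_nat (Poly_Mapping.lookup m i + 1) *
      Poly_Mapping.lookup (d (diag_field l) (PVar k)) (m + Poly_Mapping.single i 1)"
proof -
  have W: "d (pderiv_var i) \<in> W_X" "d (diag_field l) \<in> W_X"
    by (simp_all add: W_fin_imp_W_X lie_derivation_closed[OF d])
  have "poly_scale (l i) (d (pderiv_var i) (PVar k)) =
      bracket (d (pderiv_var i)) (diag_field l) (PVar k) +
      bracket (pderiv_var i) (d (diag_field l)) (PVar k)"
    using lie_derivation_bracket[OF d pderiv_var_W_fin[of i] diag_field_W_fin[of l]]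
      lie_derivation_scale[OF d pderiv_var_W_fin[of i], of "l i"]
    unfolding bracket_pderiv_diag by metis
  also have "bracket (pderiv_var i) (d (diag_field l)) (PVar k) =
      pderiv_var i (d (diag_field l) (PVar k))"
    by (simp add: bracket_def pderiv_var_PVar W_X_zero[OF W(2)] W_X_one[OF W(2)])
  also have "bracket (d (pderiv_var i)) (diag_field l) (PVar k) =
      poly_scale (l k) (d (pderiv_var i) (PVar k)) - diag_field l (d (pderiv_var i) (PVar k))"
    by (simp add: bracket_def diag_field_PVar W_X_scale[OF W(1)])
  finally have "l i * Poly_Mapping.lookup (d (pderiv_var i) (PVar k)) m =
      Poly_Mapping.lookup (poly_scale (l k) (d (pderiv_var i) (PVar k)) -
        diag_field l (d (pderiv_var i) (PVar k)) + pderiv_var i (d (diag_field l) (PVar k))) m"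
    by (metis lookup_poly_scale)
  then show ?thesis
    by (simp only: lookup_add lookup_minus lookup_poly_scale lookup_diag_field lookup_pderiv_var)
       (simp add: algebra_simps)
qed

text \<open>The coefficients of \<open>a\<close> off degree 1 are read off \<open>d E = [E, a]\<close> for the Euler field \<open>E\<close>;
  the linear part comes from the constant terms of the \<open>d (\<partial>/\<partial>x\<^sub>i)\<close>, and comparison with \<open>\<Sum>i x\<^sub>i \<partial>/\<partial>x\<^sub>i\<close>, whose
  eigenvalues are distinct, shows that this linear part lies in \<open>W_fin\<close>.\<close>

lemma lie_derivation_inner_on_generators:
  fixes d :: "('a::field_char_0 ipoly \<Rightarrow> 'a ipoly) \<Rightarrow> ('a ipoly \<Rightarrow> 'a ipoly)"
  assumes d: "lie_derivation W_fin d"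
  obtains a where "a \<in> W_fin" "\<And>i. d (pderiv_var i) = bracket (pderiv_var i) a"
    "d (diag_field (\<lambda>_. 1)) = bracket (diag_field (\<lambda>_. 1)) a"
proof -
  define u where "u k = d (diag_field (\<lambda>_. 1)) (PVar k)" for k
  define v where "v k = d (diag_field of_nat) (PVar k)" for k
  define c where "c i k = Poly_Mapping.lookup (d (pderiv_var i) (PVar k)) 0" for i k
  \<comment> \<open>A finite set carrying all nonzero \<open>c i k\<close>. The index
    \<open>k\<close> is added by hand because the factor i - k gives no information when i =
    k.\<close>
  define S where "S k = insert k (occurring (v k))" for k
  \<comment> \<open>In degree 1 the first sum contributes nothing, because \<open>x / 0 = 0\<close>.\<close>
  define a where "a k =
    (\<Sum>m\<in>Poly_Mapping.keys (u k). Poly_Mapping.single m (Poly_Mapping.lookup (u k) m / (wt (\<lambda>_. 1) m - 1))) +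
    (\<Sum>i\<in>S k. Poly_Mapping.single (Poly_Mapping.single i 1) (c i k))" for k
  have u: "wt (\<lambda>_. 1) m * Poly_Mapping.lookup (d (pderiv_var i) (PVar k)) m =
    of_nat (Poly_Mapping.lookup m i + 1) * Poly_Mapping.lookup (u k) (m + Poly_Mapping.single i 1)"
    for i k m
    using lie_derivation_diag_coeff[OF d, of "\<lambda>_. 1" i k m] by (simp add: u_def)
  \<comment> \<open>Use the weights l_i = i at \<open>m = 0\<close>: off the diagonal the factor i -
    k is nonzero.\<close>
  have c0: "c i k = 0" if "i \<notin> S k" for i k
  proof -
    have "Poly_Mapping.lookup (v k) (Poly_Mapping.single i 1) = 0"
    proof (rule ccontr)
      assume "Poly_Mapping.lookup (v k) (Poly_Mapping.single i 1) \<noteq> 0"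
      then have "i \<in> occurring (v k)"
        unfolding occurring_def by (intro UN_I[of "Poly_Mapping.single i 1"]) (auto simp: in_keys_iff)
      then show False using that by (simp add: S_def)
    qed
    then show ?thesis
      using lie_derivation_diag_coeff[OF d, of of_nat i k 0] that by (simp add: v_def c_def S_def)
  qed
  \<comment> \<open>Removing a variable from a monomial of degree 1 leaves degree 0, where the left
    side of \<open>u\<close> vanishes.\<close>
  have u1: "Poly_Mapping.lookup (u k) m = 0" if "wt (\<lambda>_. 1) m = (1::'a)" for k m
  proof -
    have "m \<noteq> 0" using that by auto
    then obtain i where i: "Poly_Mapping.lookup m i \<noteq> 0"
      by (metis lookup_zero poly_mapping_eqI)
    let ?n = "m - Poly_Mapping.single i 1"
    have "wt (\<lambda>_. 1) ?n + 1 = (1::'a)"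
      using that exponent_diff_add[OF i] wt_add[of "\<lambda>_. 1::'a" ?n "Poly_Mapping.single i 1"] by simp
    then show ?thesis
      using u[of ?n i k] unfolding exponent_diff_add[OF i] by (simp del: of_nat_Suc)
  qed
  have look: "Poly_Mapping.lookup (a k) m = Poly_Mapping.lookup (u k) m / (wt (\<lambda>_. 1) m - 1) +
      (\<Sum>i\<in>S k. c i k when Poly_Mapping.single i 1 = m)" for k m
    by (auto simp: a_def lookup_add lookup_sum lookup_single when_def in_keys_iff)
  have occ: "occurring (a k) \<subseteq> occurring (u k) \<union> S k" for k
    unfolding a_def
    by (rule order_trans[OF occurring_add], rule Un_mono; rule order_trans[OF occurring_sum])
       (auto simp: occurring_def split: if_splits)
  have fin: "finite {k. n \<in> occurring (a k)}" for n
  proof (rule finite_subset)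
    show "{k. n \<in> occurring (a k)} \<subseteq>
        {k. n \<in> occurring (u k)} \<union> insert n {k. n \<in> occurring (v k)}"
      using occ by (auto simp: S_def)
    show "finite ({k. n \<in> occurring (u k)} \<union> insert n {k. n \<in> occurring (v k)})"
      using lie_derivation_closed[OF d diag_field_W_fin] by (simp add: u_def v_def W_fin_iff)
  qed
  let ?a = "vector_field a"
  have aW: "?a \<in> W_fin" using fin by (auto simp: W_fin_def)
  then have aX: "?a \<in> W_X" by (rule W_fin_imp_W_X)
  have "d (pderiv_var i) = bracket (pderiv_var i) ?a" for i
  proof (rule W_fin_eqI)
    fix k
    have "Poly_Mapping.lookup (d (pderiv_var i) (PVar k)) m = Poly_Mapping.lookup (pderiv_var i (a k)) m" for m
    proof (cases "m = 0")
      \<comment> \<open>The constant term of \<partial>_i \<open>(a k)\<close> is the coefficient of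
        x_i in \<open>a k\<close>, to which only the linear sum contributes.\<close>
      case True
      have "(\<Sum>j\<in>S k. c j k when Poly_Mapping.single j 1 = Poly_Mapping.single i (1::nat)) = c i k"
      proof -
        have "Poly_Mapping.single j 1 = Poly_Mapping.single i (1::nat) \<longleftrightarrow> j = i" for j
          by (metis lookup_single_eq lookup_single_not_eq one_neq_zero)
        then have "(\<Sum>j\<in>S k. c j k when Poly_Mapping.single j 1 = Poly_Mapping.single i (1::nat)) =
            (\<Sum>j\<in>S k. if j = i then c j k else 0)"
          by (simp only: when_def)
        also have "\<dots> = c i k" using c0 by (auto simp: S_def)
        finally show ?thesis .
      qed
      then show ?thesis using True by (simp add: lookup_pderiv_var look c_def)
    next
      case False
      \<comment> \<open>Here the monomial has degree at least 2, so the linear sum of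
        \<open>a\<close> is absent and \<open>u\<close> determines the coefficient.\<close>
      have "Poly_Mapping.single j 1 \<noteq> m + Poly_Mapping.single i (1::nat)" for j
      proof
        assume "Poly_Mapping.single j 1 = m + Poly_Mapping.single i (1::nat)"
        then have "wt (\<lambda>_. 1::'a) (Poly_Mapping.single j 1) = wt (\<lambda>_. 1) (m + Poly_Mapping.single i 1)"
          by (rule arg_cong)
        then show False using False by (simp add: wt_add)
      qed
      then have "(\<Sum>j\<in>S k. c j k when Poly_Mapping.single j 1 = m + Poly_Mapping.single i 1) = 0"
        by simp
      moreover have "wt (\<lambda>_. 1::'a) (m + Poly_Mapping.single i 1) - 1 = wt (\<lambda>_. 1) m"
        by (simp add: wt_add)
      ultimately have "Poly_Mapping.lookup (pderiv_var i (a k)) m =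
          wt (\<lambda>_. 1) m * Poly_Mapping.lookup (d (pderiv_var i) (PVar k)) m / wt (\<lambda>_. 1) m"
        unfolding u lookup_pderiv_var look by simp
      then show ?thesis using False by simp
    qed
    then show "d (pderiv_var i) (PVar k) = bracket (pderiv_var i) ?a (PVar k)"
      by (simp add: bracket_def poly_mapping_eqI pderiv_var_PVar W_X_zero[OF aX] W_X_one[OF aX])
  qed (simp_all add: W_fin_bracket aW lie_derivation_closed[OF d])
  moreover have "d (diag_field (\<lambda>_. 1)) = bracket (diag_field (\<lambda>_. 1)) ?a"
  proof (rule W_fin_eqI)
    fix k
    \<comment> \<open>The right side is the coefficient in [E, a]; in degree 1 both sides vanish by
      \<open>u1\<close>.\<close>
    have "Poly_Mapping.lookup (u k) m = (wt (\<lambda>_. 1) m - 1) * Poly_Mapping.lookup (a k) m" for m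
    proof (cases "wt (\<lambda>_. 1) m = (1::'a)")
      case True
      then show ?thesis by (simp add: u1)
    next
      case False
      then have "Poly_Mapping.single i 1 \<noteq> m" for i by auto
      then have "(\<Sum>i\<in>S k. c i k when Poly_Mapping.single i 1 = m) = 0" by simp
      then show ?thesis using False by (simp add: look)
    qed
    then show "d (diag_field (\<lambda>_. 1)) (PVar k) = bracket (diag_field (\<lambda>_. 1)) ?a (PVar k)"
      by (intro poly_mapping_eqI)
         (simp add: bracket_def diag_field_PVar W_X_scale[OF aX] lookup_minus lookup_diag_field
          left_diff_distrib flip: u_def)
  qed (simp_all add: W_fin_bracket aW lie_derivation_closed[OF d])
  ultimately show thesis using that aW by blast
qed

section \<open>Normalization by an inner derivation, and vanishing of normalized derivations\<close>

text \<open>By the Jacobi identity x \<mapsto> [x, a] is a derivation, and derivations are closed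
  under differences.\<close>

lemma lie_derivation_diff_inner:
  assumes d: "lie_derivation W_fin d" and a: "a \<in> W_fin"
  shows "lie_derivation W_fin (\<lambda>x p. d x p - bracket x a p)"
proof -
  note X = W_fin_imp_W_X
  have 1: "(\<lambda>p. d x p - bracket x a p) \<in> W_fin" if "x \<in> W_fin" for x
    using that by (intro W_fin_diff W_fin_bracket a lie_derivation_closed[OF d])
  have 2: "d (bracket x y) p - bracket (bracket x y) a p =
      bracket (\<lambda>p. d x p - bracket x a p) y p + bracket x (\<lambda>p. d y p - bracket y a p) p"
    if "x \<in> W_fin" "y \<in> W_fin" for x y p
    unfolding lie_derivation_bracket[OF d that]
    using that a by (simp add: bracket_def X W_X_diff W_X_add algebra_simps)
  have 3: "d (\<lambda>p. x p + y p) p - bracket (\<lambda>p. x p + y p) a p =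
      (d x p - bracket x a p) + (d y p - bracket y a p)" if "x \<in> W_fin" "y \<in> W_fin" for x y p
    unfolding lie_derivation_add[OF d that]
    using W_X_add[OF X[OF a]] by (simp add: bracket_def algebra_simps)
  have 4: "d (\<lambda>p. poly_scale c (x p)) p - bracket (\<lambda>p. poly_scale c (x p)) a p =
      poly_scale c (d x p - bracket x a p)" if "x \<in> W_fin" for c x p
  proof -
    have "poly_scale c (q - r) = poly_scale c q - poly_scale c r" for q r :: "'a ipoly"
      by (simp add: poly_scale_conv_mult right_diff_distrib)
    then show ?thesis
      unfolding lie_derivation_scale[OF d that]
      by (simp add: bracket_def W_X_scale[OF X[OF a]])
  qed
  show ?thesis
    unfolding lie_derivation_def by (intro conjI ballI allI ext 1 2 3 4)
qed

locale normalized_derivation =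
  fixes d :: "('a::field_char_0 ipoly \<Rightarrow> 'a ipoly) \<Rightarrow> ('a ipoly \<Rightarrow> 'a ipoly)"
  assumes derivation: "lie_derivation W_fin d"
    and pderiv: "d (pderiv_var i) = (\<lambda>p. 0)"
    and euler: "d (diag_field (\<lambda>_. 1)) = (\<lambda>p. 0)"
begin

text \<open>As \<open>d\<close> kills \<partial>_i, the image of [\<partial>_i, x] is
  [\<partial>_i, \<open>d x\<close>], which differentiates \<open>d x\<close> componentwise.\<close>

lemma pderiv_image_eq_0:
  assumes "x \<in> W_fin" "d (bracket (pderiv_var i) x) = (\<lambda>p. 0)"
  shows "pderiv_var i (d x (PVar k)) = 0"
proof -
  have "d x \<in> W_X" by (simp add: W_fin_imp_W_X lie_derivation_closed[OF derivation] assms)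
  then have "d x 0 = 0" "d x 1 = 0" by (simp_all add: W_X_zero W_X_one)
  then show ?thesis
    using fun_cong[OF lie_derivation_bracket[OF derivation pderiv_var_W_fin assms(1), of i], of "PVar k"]
      assms W_X_zero[of x]
    by (auto simp: bracket_def pderiv pderiv_var_PVar W_fin_imp_W_X split: if_splits)
qed

text \<open>Brackets with \<partial>_i lower the degree, so by induction the image is a constant
  field. Brackets with E then compare its eigenvalue -1 with the eigenvalue |m| - 1 of the monomial
  field.\<close>

lemma monomial_field: "d (\<lambda>p. Poly_Mapping.single m 1 * pderiv_var k p) = (\<lambda>p. 0)"
proof (induction "wt (\<lambda>_. 1::nat) m" arbitrary: m rule: less_induct)
  case less
  show ?case
  proof (cases "m = 0")
    case True
    then show ?thesis using pderiv[of k] by simp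
  next
    case False
    let ?x = "\<lambda>p. Poly_Mapping.single m 1 * pderiv_var k p :: 'a ipoly"
    let ?E = "diag_field (\<lambda>_. 1 :: 'a)"
    have dX: "d ?x \<in> W_X" by (simp add: W_fin_imp_W_X lie_derivation_closed[OF derivation])
    have "pderiv_var i (d ?x (PVar l)) = 0" for i l
    proof (rule pderiv_image_eq_0)
      let ?n = "m - Poly_Mapping.single i 1"
      let ?c = "of_nat (Poly_Mapping.lookup m i) :: 'a"
      have eq: "bracket (pderiv_var i) ?x = (\<lambda>p. poly_scale ?c (Poly_Mapping.single ?n 1 * pderiv_var k p))"
      proof (rule W_fin_eqI)
        show "bracket (pderiv_var i) ?x (PVar j) =
            poly_scale ?c (Poly_Mapping.single ?n 1 * pderiv_var k (PVar j))" for j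
          by (intro poly_mapping_eqI)
             (auto simp: bracket_def pderiv_var_PVar pderiv_var_single lookup_single when_def
               W_X_zero W_X_one W_fin_imp_W_X)
      qed (simp_all add: W_fin_bracket W_fin_scale)
      show "d (bracket (pderiv_var i) ?x) = (\<lambda>p. 0)"
      proof (cases "Poly_Mapping.lookup m i = 0")
        \<comment> \<open>Truncation gives \<open>?n = m\<close>, to which the induction hypothesis
          does not apply, but the scalar is zero.\<close>
        case True
        then show ?thesis
          unfolding eq using lie_derivation_zero[OF derivation] by (simp add: poly_scale_conv_mult)
      next
        case False
        have "wt (\<lambda>_. 1::nat) m = wt (\<lambda>_. 1) ?n + 1"
          using wt_add[of "\<lambda>_. 1::nat" ?n "Poly_Mapping.single i 1"] exponent_diff_add[OF False] by simp
        then have "d (\<lambda>p. Poly_Mapping.single ?n 1 * pderiv_var k p) = (\<lambda>p. 0)"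
          by (intro less) simp
        then show ?thesis
          unfolding eq lie_derivation_scale[OF derivation monomial_field_W_fin]
          by (simp add: poly_scale_conv_mult)
      qed
    qed simp
    then have const: "Poly_Mapping.lookup (d ?x (PVar l)) n = 0" if "n \<noteq> 0" for l n
      using that by (rule pderiv_var_eq_0_imp_lookup)
    have eq: "bracket ?E ?x = (\<lambda>p. poly_scale (wt (\<lambda>_. 1) m - 1) (?x p))"
    proof (rule W_fin_eqI)
      show "bracket ?E ?x (PVar j) = poly_scale (wt (\<lambda>_. 1) m - 1) (?x (PVar j))" for j
        by (intro poly_mapping_eqI)
           (auto simp: bracket_def diag_field_PVar pderiv_var_scale pderiv_var_PVar lookup_minus
             lookup_diag_field lookup_single when_def poly_scale_conv_mult mult_single)
    qed (simp_all add: W_fin_bracket W_fin_scale)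
    show ?thesis
    proof (rule W_fin_eqI)
      fix l
      have "bracket ?E (d ?x) (PVar l) = poly_scale (wt (\<lambda>_. 1) m - 1) (d ?x (PVar l))"
        using fun_cong[OF lie_derivation_bracket[OF derivation diag_field_W_fin monomial_field_W_fin,
              of "\<lambda>_. 1" "Poly_Mapping.single m 1" k], of "PVar l"]
        unfolding eq lie_derivation_scale[OF derivation monomial_field_W_fin]
        by (simp add: euler bracket_def W_X_zero[OF dX])
      then have "Poly_Mapping.lookup (bracket ?E (d ?x) (PVar l)) 0 =
          (wt (\<lambda>_. 1) m - 1) * Poly_Mapping.lookup (d ?x (PVar l)) 0" by simp
      \<comment> \<open>The left side above is minus the constant coefficient, so the eigenvalues
        differ by |m|.\<close>
      then have "wt (\<lambda>_. 1) m * Poly_Mapping.lookup (d ?x (PVar l)) 0 = 0"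
        by (simp add: bracket_def diag_field_PVar W_X_scale[OF dX] lookup_minus lookup_diag_field
            left_diff_distrib)
      then have "Poly_Mapping.lookup (d ?x (PVar l)) 0 = 0" using False by simp
      then show "d ?x (PVar l) = 0"
        using const by (intro poly_mapping_eqI) (metis lookup_zero)
    qed (simp_all add: lie_derivation_closed[OF derivation])
  qed
qed

lemma one_component_field: "d (\<lambda>p. q * pderiv_var k p) = (\<lambda>p. 0)"
proof (induction q rule: ipoly_induct)
  case zero
  then show ?case using lie_derivation_zero[OF derivation] by simp
next
  case (single_add m c q)
  have "(\<lambda>p. (Poly_Mapping.single m c + q) * pderiv_var k p) =
      (\<lambda>p. poly_scale c (Poly_Mapping.single m 1 * pderiv_var k p) + q * pderiv_var k p)"
    by (simp add: poly_scale_conv_mult mult_single distrib_right flip: mult.assoc)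
  then show ?case
    using single_add
    by (simp add: lie_derivation_add[OF derivation] W_fin_scale lie_derivation_scale[OF derivation]
        monomial_field) (simp add: poly_scale_conv_mult)
qed

text \<open>Such a field is a finite sum of one-component fields, so additivity of \<open>d\<close>
  suffices.\<close>

lemma finite_field:
  assumes x: "x \<in> W_fin" and fin: "finite {k. x (PVar k) \<noteq> 0}"
  shows "d x = (\<lambda>p. 0)"
proof -
  have sum: "(\<lambda>p. \<Sum>k\<in>K. f k * pderiv_var k p) \<in> W_fin \<and>
      d (\<lambda>p. \<Sum>k\<in>K. f k * pderiv_var k p) = (\<lambda>p. 0)" if "finite K" for K f
    using that
  proof (induction K)
    case empty
    then show ?case using lie_derivation_zero[OF derivation] by simp
  next
    case (insert k K)
    then show ?case
      by (simp add: W_fin_add lie_derivation_add[OF derivation] one_component_field)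
  qed
  let ?K = "{k. x (PVar k) \<noteq> 0}"
  have eq: "x = (\<lambda>p. \<Sum>k\<in>?K. x (PVar k) * pderiv_var k p)"
  proof (rule W_fin_eqI[OF x])
    show "x (PVar j) = (\<Sum>k\<in>?K. x (PVar k) * pderiv_var k (PVar j))" for j
      using fin by (simp add: pderiv_var_PVar if_distrib[of "\<lambda>y. _ * y"] cong: if_cong)
  qed (rule conjunct1[OF sum[OF fin]])
  show ?thesis
    by (subst eq) (rule conjunct2[OF sum[OF fin]])
qed

text \<open>Although \<open>x\<close> may have infinitely many components, its brackets with \<open>\<partial>/\<partial>x\<^sub>i\<close> and with
  \<open>x\<^sub>j \<partial>/\<partial>x\<^sub>j\<close> have only finitely many, because every variable occurs in finitely many of them.\<close>

lemma vanishes: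
  assumes x: "x \<in> W_fin" shows "d x = (\<lambda>p. 0)"
proof -
  have fin: "finite {k. i \<in> occurring (x (PVar k))}" for i
    using x by (simp add: W_fin_iff)
  have xX: "x \<in> W_X" using x by (rule W_fin_imp_W_X)
  have dX: "d x \<in> W_X" using x by (simp add: W_fin_imp_W_X lie_derivation_closed[OF derivation])
  have "d (bracket (pderiv_var i) x) = (\<lambda>p. 0)" for i
  proof (rule finite_field)
    have "bracket (pderiv_var i) x (PVar k) = pderiv_var i (x (PVar k))" for k
      by (simp add: bracket_def pderiv_var_PVar W_X_zero[OF xX] W_X_one[OF xX])
    then have "{k. bracket (pderiv_var i) x (PVar k) \<noteq> 0} \<subseteq> {k. i \<in> occurring (x (PVar k))}"
      using pderiv_var_not_occurring[of i] by auto
    then show "finite {k. bracket (pderiv_var i) x (PVar k) \<noteq> 0}"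
      using fin by (rule finite_subset)
  qed (simp add: W_fin_bracket x)
  then have const: "pderiv_var i (d x (PVar k)) = 0" for i k
    by (rule pderiv_image_eq_0[OF x])
  show ?thesis
  proof (rule W_fin_eqI)
    fix j
    let ?y = "\<lambda>p. PVar j * pderiv_var j p :: 'a ipoly"
    have "d (bracket x ?y) = (\<lambda>p. 0)"
    proof (rule finite_field)
      show "finite {k. bracket x ?y (PVar k) \<noteq> 0}"
      proof (rule finite_subset)
        \<comment> \<open>For k other than j the component is -x_j \<partial>_j
          \<open>(x (PVar k))\<close>.\<close>
        show "{k. bracket x ?y (PVar k) \<noteq> 0} \<subseteq> insert j {k. j \<in> occurring (x (PVar k))}"
        proof (rule subsetI, rule ccontr)
          fix k
          assume "k \<in> {k. bracket x ?y (PVar k) \<noteq> 0}"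
            and "k \<notin> insert j {k. j \<in> occurring (x (PVar k))}"
          then show False
            by (simp add: bracket_def pderiv_var_PVar W_X_zero[OF xX] pderiv_var_not_occurring)
        qed
      qed (simp add: fin)
    qed (simp add: W_fin_bracket x)
    \<comment> \<open>Since the components of \<open>d x\<close> are constant, the j-th component of
      [\<open>d x\<close>, x_j \<partial>_j] is \<open>d x (PVar j)\<close> itself.\<close>
    then have "bracket (d x) ?y (PVar j) + bracket x (d ?y) (PVar j) = 0"
      using fun_cong[OF lie_derivation_bracket[OF derivation x monomial_field_W_fin], of "PVar j" j "PVar j"]
      by simp
    then show "d x (PVar j) = 0"
      by (simp add: bracket_def pderiv_var_PVar const one_component_field W_X_zero[OF xX])
  qed (simp_all add: x lie_derivation_closed[OF derivation])
qed

end

theorem theorem2: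
  fixes d :: "('a::field_char_0 ipoly \<Rightarrow> 'a ipoly) \<Rightarrow> ('a ipoly \<Rightarrow> 'a ipoly)"
  assumes "lie_derivation W_fin d"
  shows "\<exists>a\<in>W_fin. \<forall>x\<in>W_fin. d x = bracket x a"
proof -
  obtain a where a: "a \<in> W_fin" "\<And>i. d (pderiv_var i) = bracket (pderiv_var i) a"
    "d (diag_field (\<lambda>_. 1)) = bracket (diag_field (\<lambda>_. 1)) a"
    using lie_derivation_inner_on_generators[OF assms] by blast
  interpret normalized_derivation "\<lambda>x p. d x p - bracket x a p"
    by (rule normalized_derivation.intro, rule lie_derivation_diff_inner[OF assms a(1)])
       (simp_all only: a diff_self)
  have "d x p = bracket x a p" if "x \<in> W_fin" for x p
    using fun_cong[OF vanishes[OF that], of p] by simp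
  then show ?thesis using a(1) by blast
qed

end
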